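(* Let $\tau_n<T$. Consider the ordinary differential system $$V'=P(V)+H(V,\mu),\qquad g'=r_{\mathrm{alg}}(\mu,g),\qquad t'=r_{\mathrm{time}}(g)$$ coupled to an algebraic constraint which is either of the form (case 1) $0=\Psi(V,\mu)$, or (case 2) $0=\Psi(V)$. Assume that for consistent initial data $(V_\star,\mu_\star,g_\star,t_\star)$ at $\tau=\tau_n$ this differential algebraic equation has a smooth solution $(V,\mu,g,t)$ on the non-empty interval $[\tau_n,T)$, and that - in case 1, the matrix $\partial_\mu\Psi\bigl(V(\tau),\mu(\tau)\bigr)$ is invertible for every $\tau\in[\tau_n,T)$; - in case 2, the matrix $\partial_V\Psi\bigl(V(\tau)\bigr)\,\partial_\mu H\bigl(V(\tau),\mu(\tau)\bigr)$ is invertible for every $\tau\in[\tau_n,T)$. Let $V_2(h),g_2(h),t_2(h)$ (and, in case 1, $\mu_2(h)$) be the values produced by one step of size $h$ of the IMEX Runge–Kutta method described in the context, started at $\tau_n$ from $(V_\star,\mu_\star,g_\star,t_\star)$. Then the method is consistent of second order at the differential variables, i.e. in both cases, as $h\searrow 0$, $$V_2(h)=V(\tau_n+h)+\mathcal O(h^3),\qquad g_2(h)=g(\tau_n+h)+\mathcal O(h^3),\qquad t_2(h)=t(\tau_n+h)+\mathcal O(h^3).$$ Moreover, in case 1 the algebraic variables are also second order consistently approximated, i.e. $$\mu_2(h)=\mu(\tau_n+h)+\mathcal O(h^3)\quad\text{as } h\searrow 0.$$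
   Context: Setting: $V$ takes values in $\mathbb R^m$, $\mu$ in $\mathbb R^p$, $g$ in a finite-dimensional space $\mathbb R^q$, and $t$ in $\mathbb R$; a prime denotes $\frac{d}{d\tau}$. The functions $P:\mathbb R^m\to\mathbb R^m$, $H:\mathbb R^m\times\mathbb R^p\to\mathbb R^m$, $r_{\mathrm{alg}}:\mathbb R^p\times\mathbb R^q\to\mathbb R^q$, $r_{\mathrm{time}}:\mathbb R^q\to\mathbb R$ and $\Psi$ (with $\Psi:\mathbb R^m\times\mathbb R^p\to\mathbb R^p$ in case 1, $\Psi:\mathbb R^m\to\mathbb R^p$ in case 2) are (possibly nonlinear) and sufficiently smooth in their arguments. "Smooth solution" means that $V$ and $\mu$ are of class $C^3$ on $[\tau_n,T)$ and that $(V,\mu,g,t)$ satisfies the differential equations and the algebraic constraint on $[\tau_n,T)$, with $(V,\mu,g,t)(\tau_n)=(V_\star,\mu_\star,g_\star,t_\star)$. Consistency of the initial data means: in case 1, $\Psi(V_\star,\mu_\star)=0$; in case 2, $\Psi(V_\star)=0$ and $\partial_V\Psi(V_\star)\bigl(P(V_\star)+H(V_\star,\mu_\star)\bigr)=0$. The method (Heun's method coupled with the Crank–Nicolson method). Given data at $\tau_n$, set $V_0=V_\star$, $g_0=g_\star$, $t_0=t_\star$. One step of size $h$ consists in solving for $V_1,V_2,\mu_0,\mu_1,g_1,g_2,t_1,t_2$ the following equations. First stage: $$V_1=V_0+\tfrac h2P(V_0)+\tfrac h2P(V_1)+hH(V_0,\mu_0),$$ $$0=\Psi(V_0,\mu_0)\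 \text{ in case 1},\qquad 0=\Psi(V_1)\ \text{ in case 2},$$ $$g_1=g_0+h\,r_{\mathrm{alg}}(\mu_0,g_0),\qquad t_1=t_0+h\,r_{\mathrm{time}}(g_0).$$ Second stage: $$V_2=V_0+\tfrac h2P(V_0)+\tfrac h2P(V_2)+\tfrac h2H(V_0,\mu_0)+\tfrac h2H(V_1,\mu_1),$$ $$0=\Psi(V_1,\mu_1)\ \text{ in case 1},\qquad 0=\Psi(V_2)\ \text{ in case 2},$$ $$g_2=g_0+\tfrac h2r_{\mathrm{alg}}(\mu_0,g_0)+\tfrac h2r_{\mathrm{alg}}(\mu_1,g_1),\qquad t_2=t_0+\tfrac h2r_{\mathrm{time}}(g_0)+\tfrac h2r_{\mathrm{time}}(g_1).$$ The approximations at the new time $\tau_n+h$ are $V_2,g_2,t_2$. The approximation of $\mu$ at the new time is, in case 1, the solution $\mu_2$ of $\Psi(V_2,\mu_2)=0$, and in case 2 it is $\mu_1$. Standing assumption on the numerical solution: the numerical solution and all intermediate stage values depend smoothly on the step size $h$ for small $h\ge 0$; they are written $V_i(h),\mu_i(h),g_i(h),t_i(h)$. The algebraic variables are understood to be the locally unique solutions near $\mu_\star$, i.e. $\mu_0(0)=\mu_1(0)=\mu_\star$ (and $\mu_2(0)=\mu_\star$ in case 1). *)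

theory Defs
  imports "HOL-Analysis.Analysis"
begin

text \<open>
  Class \<open>C\<^sup>k\<close> on a set. On finite-dimensional spaces, asking every directional
  derivative \<open>\<lambda>x. f' x v\<close> to be \<open>C\<^sup>k\<close> is the same as asking the derivative map to be
  \<open>C\<^sup>k\<close>. Derivatives are taken within \<open>S\<close>, hence one-sided at the left end of a
  half-open interval; they are unique for the sets used here (the whole space and
  nondegenerate intervals).
\<close>

primrec Ck_on :: "nat \<Rightarrow> ('a::euclidean_space \<Rightarrow> 'b::euclidean_space) \<Rightarrow> 'a set \<Rightarrow> bool" where
  "Ck_on 0 f S \<longleftrightarrow> continuous_on S f"
| "Ck_on (Suc k) f S \<longleftrightarrow>
     (\<exists>f'. (\<forall>x\<in>S. (f has_derivative f' x) (at x within S)) \<and>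
           (\<forall>v. Ck_on k (\<lambda>x. f' x v) S))"

text \<open>
  The two admissible forms of the algebraic constraint, \<open>0 = \<Psi>(V,\<mu>)\<close> and
  \<open>0 = \<Psi>(V)\<close>. The names refer to the differentiation index that the system
  has under the respective invertibility condition.
\<close>

datatype ('v, 'u) constraint = Index1 "'v \<times> 'u \<Rightarrow> 'u" | Index2 "'v \<Rightarrow> 'u"

fun smooth_constraint ::
  "(real^'m, real^'p) constraint \<Rightarrow> bool" where
  "smooth_constraint (Index1 \<Psi>) \<longleftrightarrow> Ck_on 3 \<Psi> UNIV"
| "smooth_constraint (Index2 \<Psi>) \<longleftrightarrow> Ck_on 3 \<Psi> UNIV"

fun satisfies_constraint ::
  "(real^'m, real^'p) constraint \<Rightarrow> real^'m \<Rightarrow> real^'p \<Rightarrow> bool" where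
  "satisfies_constraint (Index1 \<Psi>) v u \<longleftrightarrow> 0 = \<Psi> (v, u)"
| "satisfies_constraint (Index2 \<Psi>) v u \<longleftrightarrow> 0 = \<Psi> v"

fun consistent_initial_data ::
  "(real^'m \<Rightarrow> real^'m) \<Rightarrow> ((real^'m) \<times> (real^'p) \<Rightarrow> real^'m) \<Rightarrow>
   (real^'m, real^'p) constraint \<Rightarrow> real^'m \<Rightarrow> real^'p \<Rightarrow> bool" where
  "consistent_initial_data P H (Index1 \<Psi>) v u \<longleftrightarrow> \<Psi> (v, u) = 0"
| "consistent_initial_data P H (Index2 \<Psi>) v u \<longleftrightarrow>
     \<Psi> v = 0 \<and> jacobian \<Psi> (at v) *v (P v + H (v, u)) = 0"

fun constraint_regular ::
  "((real^'m) \<times> (real^'p) \<Rightarrow> real^'m) \<Rightarrow>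
   (real^'m, real^'p) constraint \<Rightarrow> real^'m \<Rightarrow> real^'p \<Rightarrow> bool" where
  "constraint_regular H (Index1 \<Psi>) v u \<longleftrightarrow>
     invertible (jacobian (\<lambda>w. \<Psi> (v, w)) (at u))"
| "constraint_regular H (Index2 \<Psi>) v u \<longleftrightarrow>
     invertible (jacobian \<Psi> (at v) **
                 jacobian (\<lambda>w. H (v, w)) (at u))"

definition smooth_solution ::
  "(real^'m \<Rightarrow> real^'m) \<Rightarrow> ((real^'m) \<times> (real^'p) \<Rightarrow> real^'m) \<Rightarrow>
   ((real^'p) \<times> (real^'q) \<Rightarrow> real^'q) \<Rightarrow> (real^'q \<Rightarrow> real) \<Rightarrow>
   (real^'m, real^'p) constraint \<Rightarrow> real set \<Rightarrow>
   (real \<Rightarrow> real^'m) \<Rightarrow> (real \<Rightarrow> real^'p) \<Rightarrow> (real \<Rightarrow> real^'q) \<Rightarrow> (real \<Rightarrow> real) \<Rightarrow> bool" where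
  "smooth_solution P H r_alg r_time con I V \<mu> g t \<longleftrightarrow>
     Ck_on 3 V I \<and> Ck_on 3 \<mu> I \<and>
     (\<forall>\<tau>\<in>I.
        (V has_vector_derivative P (V \<tau>) + H (V \<tau>, \<mu> \<tau>)) (at \<tau> within I) \<and>
        (g has_vector_derivative r_alg (\<mu> \<tau>, g \<tau>)) (at \<tau> within I) \<and>
        (t has_vector_derivative r_time (g \<tau>)) (at \<tau> within I) \<and>
        satisfies_constraint con (V \<tau>) (\<mu> \<tau>))"

text \<open>
  The constraint imposed in a stage that advances from \<open>v\<close> to \<open>v'\<close> with algebraic
  unknown \<open>u\<close>: with an index-1 constraint it is imposed at the old value \<open>v\<close>, with an
  index-2 constraint at the new value \<open>v'\<close>.
\<close>

fun stage_constraint ::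
  "(real^'m, real^'p) constraint \<Rightarrow> real^'m \<Rightarrow> real^'m \<Rightarrow> real^'p \<Rightarrow> bool" where
  "stage_constraint (Index1 \<Psi>) v v' u \<longleftrightarrow> 0 = \<Psi> (v, u)"
| "stage_constraint (Index2 \<Psi>) v v' u \<longleftrightarrow> 0 = \<Psi> v'"

text \<open>
  The approximation \<open>u2\<close> of the algebraic variable at the new time, given the new
  value \<open>v2\<close> and the algebraic variable \<open>u1\<close> of the second stage.
\<close>

fun final_algebraic ::
  "(real^'m, real^'p) constraint \<Rightarrow> real^'m \<Rightarrow> real^'p \<Rightarrow> real^'p \<Rightarrow> bool" where
  "final_algebraic (Index1 \<Psi>) v2 u1 u2 \<longleftrightarrow> \<Psi> (v2, u2) = 0"
| "final_algebraic (Index2 \<Psi>) v2 u1 u2 \<longleftrightarrow> u2 = u1"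

definition heun_crank_nicolson_step ::
  "(real^'m \<Rightarrow> real^'m) \<Rightarrow> ((real^'m) \<times> (real^'p) \<Rightarrow> real^'m) \<Rightarrow>
   ((real^'p) \<times> (real^'q) \<Rightarrow> real^'q) \<Rightarrow> (real^'q \<Rightarrow> real) \<Rightarrow>
   (real^'m, real^'p) constraint \<Rightarrow> real \<Rightarrow>
   (real^'m) \<times> (real^'m) \<times> (real^'m) \<Rightarrow> (real^'p) \<times> (real^'p) \<times> (real^'p) \<Rightarrow>
   (real^'q) \<times> (real^'q) \<times> (real^'q) \<Rightarrow> real \<times> real \<times> real \<Rightarrow> bool" where
  "heun_crank_nicolson_step P H r_alg r_time con h =
     (\<lambda>(V0, V1, V2) (\<mu>0, \<mu>1, \<mu>2) (g0, g1, g2) (t0, t1, t2).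
        V1 = V0 + (h/2) *\<^sub>R P V0 + (h/2) *\<^sub>R P V1 + h *\<^sub>R H (V0, \<mu>0) \<and>
        stage_constraint con V0 V1 \<mu>0 \<and>
        g1 = g0 + h *\<^sub>R r_alg (\<mu>0, g0) \<and>
        t1 = t0 + h * r_time g0 \<and>
        V2 = V0 + (h/2) *\<^sub>R P V0 + (h/2) *\<^sub>R P V2
                + (h/2) *\<^sub>R H (V0, \<mu>0) + (h/2) *\<^sub>R H (V1, \<mu>1) \<and>
        stage_constraint con V1 V2 \<mu>1 \<and>
        g2 = g0 + (h/2) *\<^sub>R r_alg (\<mu>0, g0) + (h/2) *\<^sub>R r_alg (\<mu>1, g1) \<and>
        t2 = t0 + (h/2) * r_time g0 + (h/2) * r_time g1 \<and>
        final_algebraic con V2 \<mu>1 \<mu>2)"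

end

theory Submission
  imports Defs
begin

text \<open>
  Write \<open>m0\<close>, \<open>m1\<close>, \<open>m\<close> for the derivatives at \<open>h = 0\<close> of the stage values \<open>\<mu>0\<close>, \<open>\<mu>1\<close> and of the
  exact algebraic variable, and \<open>F = P V_star + H (V_star, \<mu>_star)\<close>,
  \<open>r = r_alg (\<mu>_star, g_star)\<close>. The right-hand side of the differential equation is averaged
  over the two stages, and at the start all curves have the correct values, so expanding to second
  order gives
  \<^item> \<open>V2 h = V_star + h F + h\<^sup>2/2 (P' F + H' (F, m0 + m1)) + O(h\<^sup>3)\<close>,
  \<^item> \<open>g2 h = g_star + h r + h\<^sup>2/2 r_alg' (m0 + m1, r) + O(h\<^sup>3)\<close>,

  while the exact \<open>V\<close> and \<open>g\<close> have the same expansions with \<open>m\<close> in the place of \<open>m0 + m1\<close>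
  (\<open>second_stage_expansion\<close>, \<open>exact_velocity_expansion\<close>, \<open>explicit_trapezoidal_expansion\<close>, \<open>exact_auxiliary_expansion\<close>). In \<open>t\<close> the algebraic variable enters only through \<open>g'\<close> at the start, so
  its expansions agree in any case. Order two therefore follows from the single identity
  \<open>m0 + m1 = m\<close>; the individual \<open>m0\<close> and \<open>m1\<close> may well be different in the two cases.

  In case 1, differentiating \<open>\<Psi> (V_star, \<mu>0) = 0\<close>, \<open>\<Psi> (V1, \<mu>1) = 0\<close> and \<open>\<Psi> (V, \<mu>) = 0\<close> shows that
  \<open>\<Psi>'\<close> annihilates \<open>(0, m0)\<close>, \<open>(F, m1)\<close> and \<open>(F, m)\<close>, hence also \<open>(0, m0 + m1 - m)\<close>, and
  \<open>\<partial>\<^sub>\<mu>\<Psi>\<close> is invertible (\<open>zero_set_tangent\<close>). In case 2, \<open>V2\<close> and the exact \<open>V\<close> stay in the zero set of \<open>\<Psi>\<close>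
  and first differ in the term \<open>h\<^sup>2/2 \<partial>\<^sub>\<mu>H (m0 + m1 - m)\<close>; two curves in a level set that share their
  first-order part have second coefficients differing by a vector in the kernel of \<open>\<partial>\<^sub>V\<Psi>\<close>
  (\<open>level_set_second_coefficient\<close>), and \<open>\<partial>\<^sub>V\<Psi> \<partial>\<^sub>\<mu>H\<close> is invertible. The contributions of \<open>\<Psi>''\<close> along the two curves
  cancel. Finally, in case 1 the solution \<open>\<mu>2\<close> of \<open>\<Psi> (V2, \<mu>2) = 0\<close> depends on \<open>V2\<close> in a
  Lipschitz manner, so the error \<open>O(h\<^sup>3)\<close> of \<open>V2\<close> carries over to \<open>\<mu>2\<close> (\<open>implicit_solution_stability\<close>).
\<close>

section \<open>Orders of vanishing at the right of zero\<close>

text \<open>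
  The relation \<open>X h = O(h\<^sup>k)\<close> as \<open>h \<searrow> 0\<close>, for \<open>X\<close> with values in a normed space rather than a field.
\<close>

definition vanishes :: "nat \<Rightarrow> (real \<Rightarrow> 'a::real_normed_vector) \<Rightarrow> bool" where
  "vanishes k X \<longleftrightarrow> (\<exists>C. \<forall>\<^sub>F h in at_right 0. norm (X h) \<le> C * h ^ k)"

lemma eventually_0_less_and_less: "\<forall>\<^sub>F h in at_right 0. 0 < h \<and> h < d" if "0 < d" for d :: real
  using that eventually_at_right[of "0::real"] by auto

lemma vanishesI: "\<forall>\<^sub>F h in at_right 0. norm (X h) \<le> C * h ^ k \<Longrightarrow> vanishes k X"
  by (auto simp: vanishes_def)

lemma vanishes_pos_bound:
  assumes "vanishes k X"
  obtains C where "C > 0" "\<forall>\<^sub>F h in at_right 0. norm (X h) \<le> C * h ^ k"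
proof -
  obtain C where C: "\<forall>\<^sub>F h in at_right 0. norm (X h) \<le> C * h ^ k"
    using assms by (auto simp: vanishes_def)
  have "\<forall>\<^sub>F h in at_right 0. norm (X h) \<le> (\<bar>C\<bar> + 1) * h ^ k"
    using C eventually_0_less_and_less[OF zero_less_one]
  proof eventually_elim
    case (elim h)
    have "C * h ^ k \<le> (\<bar>C\<bar> + 1) * h ^ k"
      using elim by (intro mult_right_mono) auto
    then show ?case using elim by linarith
  qed
  then show thesis by (rule that[rotated]) simp
qed

lemma vanishes_cong_eventually:
  assumes "vanishes k X" "\<forall>\<^sub>F h in at_right 0. X h = Y h"
  shows "vanishes k Y"
proof -
  obtain C where "\<forall>\<^sub>F h in at_right 0. norm (X h) \<le> C * h ^ k"
    using assms by (auto simp: vanishes_def)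
  then have "\<forall>\<^sub>F h in at_right 0. norm (Y h) \<le> C * h ^ k"
    using assms(2) by eventually_elim simp
  then show ?thesis by (rule vanishesI)
qed

lemma vanishes_zero: "vanishes k (\<lambda>h. 0)"
  by (rule vanishesI[of _ 0]) simp

lemma vanishes_add:
  assumes "vanishes k X" "vanishes k Y"
  shows "vanishes k (\<lambda>h. X h + Y h)"
proof -
  obtain C D where "\<forall>\<^sub>F h in at_right 0. norm (X h) \<le> C * h ^ k"
    "\<forall>\<^sub>F h in at_right 0. norm (Y h) \<le> D * h ^ k"
    using assms by (auto simp: vanishes_def)
  then have "\<forall>\<^sub>F h in at_right 0. norm (X h + Y h) \<le> (C + D) * h ^ k"
  proof eventually_elim
    case (elim h)
    then show ?case using norm_triangle_ineq[of "X h" "Y h"] by (simp add: distrib_right)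
  qed
  then show ?thesis by (rule vanishesI)
qed

lemma vanishes_linear_image:
  assumes "vanishes k X" "bounded_linear L"
  shows "vanishes k (\<lambda>h. L (X h))"
proof -
  obtain C where C: "\<forall>\<^sub>F h in at_right 0. norm (X h) \<le> C * h ^ k"
    using assms by (auto simp: vanishes_def)
  obtain K where "K > 0" and K: "\<And>x. norm (L x) \<le> norm x * K"
    using assms(2) bounded_linear.pos_bounded by blast
  have "\<forall>\<^sub>F h in at_right 0. norm (L (X h)) \<le> (C * K) * h ^ k"
    using C
  proof eventually_elim
    case (elim h)
    have "norm (X h) * K \<le> C * h ^ k * K" using elim \<open>K > 0\<close> by (intro mult_right_mono) auto
    then show ?case using K[of "X h"] by (simp add: ac_simps)
  qed
  then show ?thesis by (rule vanishesI)
qed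

lemma vanishes_scaleR: "vanishes k X \<Longrightarrow> vanishes k (\<lambda>h. c *\<^sub>R X h)"
  by (rule vanishes_linear_image[OF _ bounded_linear_scaleR_right])

lemma vanishes_diff:
  "vanishes k X \<Longrightarrow> vanishes k Y \<Longrightarrow> vanishes k (\<lambda>h. X h - Y h)"
  using vanishes_add[of k X "\<lambda>h. (- 1) *\<^sub>R Y h"] vanishes_scaleR[of k Y "- 1"] by simp

lemma vanishes_mult_power:
  assumes "vanishes k X" shows "vanishes (k + l) (\<lambda>h. h ^ l *\<^sub>R X h)"
proof -
  obtain C where "\<forall>\<^sub>F h in at_right 0. norm (X h) \<le> C * h ^ k"
    using assms by (auto simp: vanishes_def)
  then have "\<forall>\<^sub>F h in at_right 0. norm (h ^ l *\<^sub>R X h) \<le> C * h ^ (k + l)"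
    using eventually_0_less_and_less[OF zero_less_one]
    by eventually_elim (simp add: power_add mult.commute mult.left_commute mult_left_mono)
  then show ?thesis by (rule vanishesI)
qed

lemma vanishes_mono:
  assumes "vanishes k X" "l \<le> k" shows "vanishes l X"
proof -
  obtain C where "C > 0" and C: "\<forall>\<^sub>F h in at_right 0. norm (X h) \<le> C * h ^ k"
    using assms vanishes_pos_bound by blast
  have "\<forall>\<^sub>F h in at_right 0. norm (X h) \<le> C * h ^ l"
    using C eventually_0_less_and_less[OF zero_less_one]
  proof eventually_elim
    case (elim h)
    then have "C * h ^ k \<le> C * h ^ l"
      using \<open>C > 0\<close> \<open>l \<le> k\<close> by (intro mult_left_mono power_decreasing) auto
    then show ?case using elim by linarith
  qed
  then show ?thesis by (rule vanishesI)
qed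

lemma vanishes_power: "vanishes k (\<lambda>h. h ^ k *\<^sub>R c)"
  by (rule vanishesI[of _ "norm c"], rule eventually_mono[OF eventually_0_less_and_less[OF zero_less_one]]) simp

lemma vanishes_Suc_tendsto:
  assumes "vanishes (Suc k) X" shows "(X \<longlongrightarrow> 0) (at_right 0)"
proof -
  obtain C where C: "\<forall>\<^sub>F h in at_right 0. norm (X h) \<le> C * h ^ Suc k"
    using assms by (auto simp: vanishes_def)
  have "((\<lambda>h::real. C * h ^ Suc k) \<longlongrightarrow> C * 0 ^ Suc k) (at_right 0)"
    by (intro tendsto_intros)
  then show ?thesis using C by (intro Lim_null_comparison[OF C]) simp
qed

lemma vanishes_power_coefficient:
  assumes "vanishes (Suc k) (\<lambda>h. h ^ k *\<^sub>R w)" shows "w = 0"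
proof -
  obtain C where "\<forall>\<^sub>F h in at_right 0. norm (h ^ k *\<^sub>R w) \<le> C * h ^ Suc k"
    using assms by (auto simp: vanishes_def)
  then have "\<forall>\<^sub>F h in at_right 0. norm w \<le> C * h ^ 1"
    using eventually_0_less_and_less[OF zero_less_one] by eventually_elim (auto simp: field_simps)
  then have "vanishes (Suc 0) (\<lambda>h. w)" by (intro vanishesI) auto
  then have "((\<lambda>h. w) \<longlongrightarrow> 0) (at_right (0::real))" by (rule vanishes_Suc_tendsto)
  then show ?thesis by (simp add: tendsto_const_iff)
qed

lemma vanishes_imp_bigo:
  assumes "vanishes k X" shows "(\<lambda>h. norm (X h)) \<in> O[at_right 0](\<lambda>h. h ^ k)"
proof -
  obtain C where "\<forall>\<^sub>F h in at_right 0. norm (X h) \<le> C * h ^ k"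
    using assms by (auto simp: vanishes_def)
  then have "\<forall>\<^sub>F h in at_right 0. norm (norm (X h)) \<le> C * norm (h ^ k)"
    using eventually_0_less_and_less[OF zero_less_one] by eventually_elim simp
  then show ?thesis by (rule bigoI)
qed

text \<open>
  Integration gains one order. On \<open>[0, h]\<close> the derivative is bounded by \<open>C h\<^sup>k\<close>, except
  perhaps at the end point \<open>0\<close>; hence the mean value inequality that looks at the open interval only.
\<close>

lemma vanishes_antiderivative:
  fixes X :: "real \<Rightarrow> 'a::real_inner"
  assumes "0 < d"
    and der: "\<And>h. h \<in> {0..<d} \<Longrightarrow> (X has_vector_derivative x h) (at h within {0..<d})"
    and "X 0 = 0" and "vanishes k x"
  shows "vanishes (Suc k) X"
proof -
  obtain C where "C > 0" and C: "\<forall>\<^sub>F h in at_right 0. norm (x h) \<le> C * h ^ k"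
    using assms vanishes_pos_bound by blast
  obtain b where "b > 0" and b: "\<And>h. 0 < h \<Longrightarrow> h < b \<Longrightarrow> norm (x h) \<le> C * h ^ k"
    using C unfolding eventually_at_right_field by auto
  have "0 < min b d" using \<open>d > 0\<close> \<open>b > 0\<close> by simp
  have "\<forall>\<^sub>F h in at_right 0. norm (X h) \<le> C * h ^ Suc k"
    using eventually_0_less_and_less[OF \<open>0 < min b d\<close>]
  proof eventually_elim
    case (elim h)
    then have h: "0 < h" "h < b" "h < d" by auto
    have "continuous_on {0..<d} X"
      unfolding continuous_on_eq_continuous_within
      by (intro ballI has_vector_derivative_continuous[OF der])
    then have "continuous_on {0..h} X"
      by (rule continuous_on_subset) (use h in auto)
    moreover have "(X has_derivative (\<lambda>s. s *\<^sub>R x y)) (at y)" if "0 < y" "y < h" for y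
    proof -
      have "(X has_vector_derivative x y) (at y within {0<..<d})"
        by (rule has_vector_derivative_within_subset[OF der]) (use that h in auto)
      then show ?thesis
        using that h by (simp add: has_vector_derivative_def at_within_open[of y "{0<..<d}"])
    qed
    ultimately obtain y where y: "0 < y" "y < h" "norm (X h - X 0) \<le> norm ((h - 0) *\<^sub>R x y)"
      using mvt_general[of 0 h X "\<lambda>y s. s *\<^sub>R x y"] h by auto
    have "norm (x y) \<le> C * y ^ k" using b y h by auto
    also have "\<dots> \<le> C * h ^ k"
      using y \<open>C > 0\<close> by (intro mult_left_mono power_mono) auto
    finally have "h * norm (x y) \<le> h * (C * h ^ k)" using h by (intro mult_left_mono) auto
    moreover have "norm (X h) \<le> h * norm (x y)" using y h \<open>X 0 = 0\<close> by simp
    moreover have "h * (C * h ^ k) = C * h ^ Suc k" by simp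
    ultimately show ?case by linarith
  qed
  then show ?thesis by (rule vanishesI)
qed

section \<open>Taylor expansions of curves\<close>

definition taylor1 :: "(real \<Rightarrow> 'a::real_normed_vector) \<Rightarrow> 'a \<Rightarrow> 'a \<Rightarrow> bool" where
  "taylor1 X a b \<longleftrightarrow> vanishes 2 (\<lambda>h. X h - (a + h *\<^sub>R b))"

text \<open>
  Here \<open>c\<close> is the whole coefficient of \<open>h\<^sup>2\<close>, that is, half the second derivative.
\<close>

definition taylor2 :: "(real \<Rightarrow> 'a::real_normed_vector) \<Rightarrow> 'a \<Rightarrow> 'a \<Rightarrow> 'a \<Rightarrow> bool" where
  "taylor2 X a b c \<longleftrightarrow> vanishes 3 (\<lambda>h. X h - (a + h *\<^sub>R b + h\<^sup>2 *\<^sub>R c))"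

lemma taylor1_const: "taylor1 (\<lambda>h. a) a 0"
  by (simp add: taylor1_def vanishes_zero)

lemma taylor1_add:
  "taylor1 X a b \<Longrightarrow> taylor1 Y c d \<Longrightarrow> taylor1 (\<lambda>h. X h + Y h) (a + c) (b + d)"
  unfolding taylor1_def by (drule (1) vanishes_add) (simp add: algebra_simps)

lemma taylor1_scaleR: "taylor1 X a b \<Longrightarrow> taylor1 (\<lambda>h. r *\<^sub>R X h) (r *\<^sub>R a) (r *\<^sub>R b)"
  unfolding taylor1_def by (drule vanishes_scaleR[of _ _ r]) (simp add: algebra_simps)

lemma taylor1_Pair:
  assumes "taylor1 X a b" "taylor1 Y c d"
  shows "taylor1 (\<lambda>h. (X h, Y h)) (a, c) (b, d)"
proof -
  have fst: "bounded_linear (\<lambda>x::'a. (x, 0::'b))" and snd: "bounded_linear (\<lambda>y::'b. (0::'a, y))"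
    by (auto intro!: bounded_linear_Pair bounded_linear_ident bounded_linear_zero)
  have "vanishes 2 (\<lambda>h. (X h - (a + h *\<^sub>R b), 0) + (0, Y h - (c + h *\<^sub>R d)))"
    using vanishes_add[OF vanishes_linear_image[OF assms(1)[unfolded taylor1_def] fst]
        vanishes_linear_image[OF assms(2)[unfolded taylor1_def] snd]] .
  then show ?thesis by (simp add: taylor1_def)
qed

lemma taylor1_remainder: "taylor1 X a b \<Longrightarrow> vanishes 1 (\<lambda>h. X h - a)"
  unfolding taylor1_def
  using vanishes_add[OF vanishes_mono[of 2 "\<lambda>h. X h - (a + h *\<^sub>R b)" 1] vanishes_power[of 1 b]]
  by simp

lemma taylor1_tendsto:
  assumes "taylor1 X a b" shows "(X \<longlongrightarrow> a) (at_right 0)"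
  using vanishes_Suc_tendsto[of 0] taylor1_remainder[OF assms] by (simp add: Lim_null[of X])

lemma taylor2_imp_taylor1:
  assumes "taylor2 X a b c" shows "taylor1 X a b"
proof -
  have "vanishes 2 (\<lambda>h. X h - (a + h *\<^sub>R b + h\<^sup>2 *\<^sub>R c) + h\<^sup>2 *\<^sub>R c)"
    using assms unfolding taylor2_def
    by (intro vanishes_add vanishes_power) (rule vanishes_mono, auto)
  then show ?thesis by (simp add: taylor1_def algebra_simps)
qed

lemma taylor2_difference:
  assumes "taylor2 X a b c" "taylor2 Y a b c'"
  shows "vanishes 3 (\<lambda>h. X h - Y h - h\<^sup>2 *\<^sub>R (c - c'))"
  using vanishes_diff[OF assms[unfolded taylor2_def]] by (simp add: algebra_simps)

lemma taylor2_difference_order2: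
  assumes "taylor2 X a b c" "taylor2 Y a b c'"
  shows "vanishes 2 (\<lambda>h. X h - Y h)"
  using vanishes_diff[of 2, OF assms[THEN taylor2_imp_taylor1, unfolded taylor1_def]] by simp

text \<open>
  The factor \<open>h\<close> in front of the increment of a Runge--Kutta step gains one order: only a
  first-order expansion of the stage derivatives is needed. Since they may themselves depend on \<open>X\<close>, as in
  an implicit stage, the lemma is also used to improve a crude expansion of \<open>X\<close>.
\<close>

lemma taylor2_increment:
  assumes "taylor1 K b c" "\<forall>\<^sub>F h in at_right 0. X h = a + h *\<^sub>R K h"
  shows "taylor2 X a b c"
proof -
  have "vanishes (2 + 1) (\<lambda>h. h ^ 1 *\<^sub>R (K h - (b + h *\<^sub>R c)))"
    using assms(1) unfolding taylor1_def by (rule vanishes_mult_power)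
  then have "vanishes (2 + 1) (\<lambda>h. X h - (a + h *\<^sub>R b + h\<^sup>2 *\<^sub>R c))"
    by (rule vanishes_cong_eventually)
      (use assms(2) in eventually_elim, simp add: algebra_simps power2_eq_square)
  then show ?thesis by (simp add: taylor2_def)
qed

lemma taylor2_antiderivative:
  fixes X :: "real \<Rightarrow> 'a::real_inner"
  assumes "0 < d"
    and der: "\<And>h. h \<in> {0..<d} \<Longrightarrow> (X has_vector_derivative x h) (at h within {0..<d})"
    and "taylor1 x a b"
  shows "taylor2 X (X 0) a ((1/2) *\<^sub>R b)"
proof -
  have "vanishes (Suc 2) (\<lambda>h. X h - (X 0 + h *\<^sub>R a + h\<^sup>2 *\<^sub>R ((1/2) *\<^sub>R b)))"
  proof (rule vanishes_antiderivative[OF \<open>0 < d\<close>])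
    show "((\<lambda>h. X h - (X 0 + h *\<^sub>R a + h\<^sup>2 *\<^sub>R ((1/2) *\<^sub>R b))) has_vector_derivative
        x h - (a + h *\<^sub>R b)) (at h within {0..<d})" if "h \<in> {0..<d}" for h
      by (rule derivative_eq_intros der[OF that] refl | simp)+
    show "vanishes 2 (\<lambda>h. x h - (a + h *\<^sub>R b))" using assms(3) by (simp add: taylor1_def)
  qed simp
  then show ?thesis by (simp add: taylor2_def numeral_3_eq_3 numeral_2_eq_2)
qed

text \<open>
  Differentiability of \<open>x\<close> at the single point \<open>0\<close> gives \<open>x h = x 0 + O(h)\<close>, and integration
  turns this into a remainder of order two.
\<close>

lemma taylor1_of_differentiable_derivative:
  fixes X :: "real \<Rightarrow> 'a::real_inner"
  assumes "0 < d"
    and der: "\<And>h. h \<in> {0..<d} \<Longrightarrow> (X has_vector_derivative x h) (at h within {0..<d})"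
    and "x differentiable (at 0 within {0..<d})"
  shows "taylor1 X (X 0) (x 0)"
proof -
  obtain D where D: "(x has_derivative D) (at 0 within {0..<d})"
    using assms(3) by (auto simp: differentiable_def)
  then obtain K where K: "K > 0" "\<And>y. norm (D y) \<le> norm y * K"
    using has_derivative_bounded_linear bounded_linear.pos_bounded by blast
  obtain e where e: "e > 0" "\<And>y. y \<in> {0..<d} \<Longrightarrow> norm y < e \<Longrightarrow>
      norm (x y - x 0 - D y) \<le> 1 * norm y"
    using D[unfolded has_derivative_within_alt, THEN conjunct2, rule_format, OF zero_less_one]
    by auto
  have "0 < min d e" using \<open>d > 0\<close> \<open>e > 0\<close> by simp
  have "\<forall>\<^sub>F h in at_right 0. norm (x h - x 0) \<le> (1 + K) * h ^ 1"
    using eventually_0_less_and_less[OF \<open>0 < min d e\<close>]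
  proof eventually_elim
    case (elim h)
    then have "norm (x h - x 0 - D h) \<le> h" "norm (D h) \<le> h * K"
      using e(2)[of h] K(2)[of h] by auto
    then show ?case
      using norm_triangle_ineq2[of "x h - x 0" "D h"] by (simp add: algebra_simps)
  qed
  then have "vanishes 1 (\<lambda>h. x h - x 0)" by (rule vanishesI)
  have "vanishes (Suc 1) (\<lambda>h. X h - (X 0 + h *\<^sub>R x 0))"
  proof (rule vanishes_antiderivative[OF \<open>0 < d\<close>])
    show "((\<lambda>h. X h - (X 0 + h *\<^sub>R x 0)) has_vector_derivative x h - x 0) (at h within {0..<d})"
      if "h \<in> {0..<d}" for h
      by (rule derivative_eq_intros der[OF that] refl | simp)+
  qed (simp, fact)
  then show ?thesis by (simp add: taylor1_def numeral_2_eq_2)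
qed

section \<open>Twice continuously differentiable maps and curves\<close>

lemma Ck_on_Suc_imp: "Ck_on (Suc k) f S \<Longrightarrow> Ck_on k f S"
proof (induction k arbitrary: f)
  case 0
  then show ?case
    by (auto simp: continuous_on_eq_continuous_within intro: has_derivative_continuous)
next
  case (Suc k)
  then obtain f' where "\<forall>x\<in>S. (f has_derivative f' x) (at x within S)"
    "\<forall>v. Ck_on (Suc k) (\<lambda>x. f' x v) S"
    by (auto simp only: Ck_on.simps)
  with Suc.IH show ?case by (auto simp only: Ck_on.simps)
qed

lemma Ck_on_3_imp_2: "Ck_on 3 f S \<Longrightarrow> Ck_on 2 f S"
  using Ck_on_Suc_imp[of 2 f S] by simp

lemma Ck_on_2_derivative:
  assumes "Ck_on 2 f S"
  obtains f' where "\<And>x. x \<in> S \<Longrightarrow> (f has_derivative f' x) (at x within S)"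
    and "\<And>x v. x \<in> S \<Longrightarrow> (\<lambda>x. f' x v) differentiable (at x within S)"
proof -
  obtain f' where "\<forall>x\<in>S. (f has_derivative f' x) (at x within S)"
    and C1: "\<forall>v. Ck_on (Suc 0) (\<lambda>x. f' x v) S"
    using assms by (auto simp only: numeral_2_eq_2 Ck_on.simps(2))
  moreover have "(\<lambda>x. f' x v) differentiable (at x within S)" if "x \<in> S" for x v
    using C1[rule_format, of v] that by (auto simp: differentiable_def)
  ultimately show thesis by (intro that) auto
qed

lemma has_derivative_imp_linear_growth:
  assumes "(g has_derivative G) (at x)"
  shows "\<exists>K. \<forall>\<^sub>F y in nhds x. norm (g y - g x) \<le> K * norm (y - x)"
proof -
  obtain K where K: "K > 0" "\<And>y. norm (G y) \<le> norm y * K"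
    using assms has_derivative_bounded_linear bounded_linear.pos_bounded by blast
  obtain e where e: "e > 0" "\<And>y. norm (y - x) < e \<Longrightarrow>
      norm (g y - g x - G (y - x)) \<le> 1 * norm (y - x)"
    using assms[unfolded has_derivative_within_alt, THEN conjunct2, rule_format, OF zero_less_one]
    by auto
  have "norm (g y - g x) \<le> (1 + K) * norm (y - x)" if "norm (y - x) < e" for y
    using e(2)[OF that] K(2)[of "y - x"] norm_triangle_ineq2[of "g y - g x" "G (y - x)"]
    by (simp add: algebra_simps)
  then show ?thesis
    unfolding eventually_nhds_metric dist_norm using e(1) by blast
qed

text \<open>
  The derivative of \<open>f\<close> deviates from \<open>D\<close> by at most \<open>C \<rho>\<close> on the ball of radius \<open>\<rho>\<close> about \<open>x0\<close>,
  because its values on the finitely many basis vectors are differentiable at \<open>x0\<close>; the mean value inequality for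
  \<open>f - D\<close> on that ball does the rest. With \<open>y = x0\<close> this is the quadratic Taylor remainder. With both
  points variable it compares two solutions of one equation.
\<close>

lemma strict_derivative_quadratic_remainder:
  fixes f :: "'a::euclidean_space \<Rightarrow> 'b::euclidean_space"
  assumes "Ck_on 2 f UNIV" and D: "(f has_derivative D) (at x0)"
  obtains C r where "C > 0" "r > 0"
    "\<And>x y \<rho>. \<lbrakk>\<rho> < r; norm (x - x0) \<le> \<rho>; norm (y - x0) \<le> \<rho>\<rbrakk> \<Longrightarrow>
      norm (f x - f y - D (x - y)) \<le> C * \<rho> * norm (x - y)"
proof -
  obtain f' where der: "\<And>x. (f has_derivative f' x) (at x)"
    and diff: "\<And>x v. (\<lambda>x. f' x v) differentiable (at x)"
    using Ck_on_2_derivative[OF assms(1)] by auto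
  have lin: "linear (f' x)" for x using der has_derivative_linear by blast
  have [simp]: "f' x0 = D" using der D has_derivative_unique by blast
  have "\<exists>K. \<forall>\<^sub>F y in nhds x0. norm (f' y b - D b) \<le> K * norm (y - x0)" for b
  proof -
    obtain G where "((\<lambda>x. f' x b) has_derivative G) (at x0)"
      using diff[of b x0] by (auto simp: differentiable_def)
    from has_derivative_imp_linear_growth[OF this] show ?thesis by simp
  qed
  then obtain K where K: "\<And>b. \<forall>\<^sub>F y in nhds x0. norm (f' y b - D b) \<le> K b * norm (y - x0)"
    by metis
  have "\<forall>\<^sub>F y in nhds x0. \<forall>b\<in>Basis. norm (f' y b - D b) \<le> K b * norm (y - x0)"
    using K by (simp add: eventually_ball_finite_distrib)
  then obtain r where r: "r > 0" "\<And>y b. norm (y - x0) < r \<Longrightarrow> b \<in> Basis \<Longrightarrow>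
      norm (f' y b - D b) \<le> K b * norm (y - x0)"
    unfolding eventually_nhds_metric dist_norm by metis
  define C where "C = (\<Sum>b\<in>Basis. \<bar>K b\<bar>) + 1"
  have "C > 0" unfolding C_def by (simp add: add_nonneg_pos sum_nonneg)
  have bound: "norm (f' z v - D v) \<le> C * \<rho> * norm v" if z: "norm (z - x0) \<le> \<rho>" "\<rho> < r" for z v \<rho>
  proof -
    have "\<rho> \<ge> 0" using z norm_ge_zero[of "z - x0"] by linarith
    define L where "L = (\<lambda>v. f' z v - D v)"
    have L: "linear L" unfolding L_def using lin[of z] lin[of x0] by (simp add: linear_compose_sub)
    have "L v = L (\<Sum>b\<in>Basis. (v \<bullet> b) *\<^sub>R b)" by (simp only: euclidean_representation)
    also have "\<dots> = (\<Sum>b\<in>Basis. (v \<bullet> b) *\<^sub>R L b)"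
      by (simp only: linear_sum[OF L] linear_cmul[OF L])
    finally have "norm (L v) \<le> (\<Sum>b\<in>Basis. norm ((v \<bullet> b) *\<^sub>R L b))"
      using norm_sum[of "\<lambda>b. (v \<bullet> b) *\<^sub>R L b" "Basis :: 'a set"] by (simp only:)
    also have "\<dots> \<le> (\<Sum>b\<in>Basis. norm v * (\<bar>K b\<bar> * \<rho>))"
    proof (rule sum_mono)
      fix b :: 'a assume b: "b \<in> Basis"
      have "norm (L b) \<le> K b * norm (z - x0)" using r(2)[of z b] z b by (simp add: L_def)
      also have "\<dots> \<le> \<bar>K b\<bar> * \<rho>" using z by (intro mult_mono) auto
      finally show "norm ((v \<bullet> b) *\<^sub>R L b) \<le> norm v * (\<bar>K b\<bar> * \<rho>)"
        using Basis_le_norm[OF b, of v] by (simp add: mult_mono)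
    qed
    also have "\<dots> = (\<Sum>b\<in>Basis. \<bar>K b\<bar>) * (\<rho> * norm v)"
      by (simp add: sum_distrib_left sum_distrib_right ac_simps)
    also have "\<dots> \<le> C * (\<rho> * norm v)"
      unfolding C_def using \<open>\<rho> \<ge> 0\<close> by (intro mult_right_mono) auto
    finally show ?thesis by (simp add: L_def ac_simps)
  qed
  have "norm (f x - f y - D (x - y)) \<le> C * \<rho> * norm (x - y)"
    if "\<rho> < r" "norm (x - x0) \<le> \<rho>" "norm (y - x0) \<le> \<rho>" for x y \<rho>
  proof -
    have "\<rho> \<ge> 0" using that norm_ge_zero[of "x - x0"] by linarith
    have "norm ((f x - D x) - (f y - D y)) \<le> C * \<rho> * norm (x - y)"
    proof (rule differentiable_bound[where S = "cball x0 \<rho>" and f' = "\<lambda>z v. f' z v - D v"])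
      show "((\<lambda>z. f z - D z) has_derivative (\<lambda>v. f' z v - D v)) (at z within cball x0 \<rho>)" for z
        using der[of z] has_derivative_bounded_linear[OF D]
        by (auto intro!: derivative_intros bounded_linear_imp_has_derivative
            intro: has_derivative_at_withinI)
      show "onorm (\<lambda>v. f' z v - D v) \<le> C * \<rho>" if "z \<in> cball x0 \<rho>" for z
        using bound[of z \<rho>] that \<open>\<rho> < r\<close> \<open>\<rho> \<ge> 0\<close> \<open>C > 0\<close>
        by (intro onorm_bound) (auto simp: dist_norm norm_minus_commute)
    qed (use that in \<open>auto simp: dist_norm norm_minus_commute\<close>)
    then show ?thesis
      by (simp add: linear_diff[OF has_derivative_linear[OF D]] algebra_simps)
  qed
  with \<open>C > 0\<close> \<open>r > 0\<close> show thesis by (rule that)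
qed

text \<open>
  The remainder of \<open>f\<close> is quadratic in \<open>X h - a = O(h)\<close>.
\<close>

lemma taylor1_compose:
  fixes f :: "'a::euclidean_space \<Rightarrow> 'b::euclidean_space"
  assumes f: "Ck_on 2 f UNIV" and D: "(f has_derivative D) (at a)" and X: "taylor1 X a b"
  shows "taylor1 (\<lambda>h. f (X h)) (f a) (D b)"
proof -
  obtain C r where "C > 0" "r > 0" and rem: "\<And>x y \<rho>. \<lbrakk>\<rho> < r; norm (x - a) \<le> \<rho>; norm (y - a) \<le> \<rho>\<rbrakk> \<Longrightarrow>
      norm (f x - f y - D (x - y)) \<le> C * \<rho> * norm (x - y)"
    using strict_derivative_quadratic_remainder[OF f D] by metis
  have D': "bounded_linear D" using D by (rule has_derivative_bounded_linear)
  obtain K where K: "\<forall>\<^sub>F h in at_right 0. norm (X h - a) \<le> K * h ^ 1"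
    using taylor1_remainder[OF X] by (auto simp: vanishes_def)
  have "\<forall>\<^sub>F h in at_right 0. norm (X h - a) < r"
    using tendstoD[OF taylor1_tendsto[OF X] \<open>r > 0\<close>] by (simp add: dist_norm)
  with K have "\<forall>\<^sub>F h in at_right 0. norm (f (X h) - f a - D (X h - a)) \<le> (C * K\<^sup>2) * h\<^sup>2"
  proof eventually_elim
    case (elim h)
    have "norm (f (X h) - f a - D (X h - a)) \<le> C * (norm (X h - a))\<^sup>2"
      using rem[of "norm (X h - a)" "X h" a] elim by (simp add: power2_eq_square)
    also have "\<dots> \<le> C * (K * h)\<^sup>2"
      using elim \<open>C > 0\<close> by (intro mult_left_mono power_mono) auto
    finally show ?case by (simp add: power_mult_distrib)
  qed
  then have "vanishes 2 (\<lambda>h. f (X h) - f a - D (X h - a))" by (rule vanishesI)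
  moreover have "vanishes 2 (\<lambda>h. D (X h - (a + h *\<^sub>R b)))"
    using X[unfolded taylor1_def] D' by (rule vanishes_linear_image)
  ultimately have "vanishes 2 (\<lambda>h. f (X h) - f a - D (X h - a) + D (X h - (a + h *\<^sub>R b)))"
    by (rule vanishes_add)
  then show ?thesis
    by (simp add: taylor1_def bounded_linear.linear[OF D'] linear_add linear_diff linear_cmul algebra_simps)
qed

lemma has_vector_derivative_shift:
  assumes "(X has_vector_derivative x) (at (a + h) within {a..<b})"
  shows "((\<lambda>h. X (a + h)) has_vector_derivative x) (at h within {0..<b - a})"
proof -
  have "((\<lambda>h. X (a + h)) has_derivative (\<lambda>s. s *\<^sub>R x)) (at h within {0..<b - a})"
  proof (rule has_derivative_in_compose[where f = "\<lambda>h. a + h" and f' = "\<lambda>s. s"])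
    show "(X has_derivative (\<lambda>s. s *\<^sub>R x)) (at (a + h) within (+) a ` {0..<b - a})"
      using assms by (simp add: has_vector_derivative_def)
  qed (auto intro!: derivative_eq_intros)
  then show ?thesis by (simp add: has_vector_derivative_def)
qed

lemma differentiable_shift:
  fixes X :: "real \<Rightarrow> 'a::real_normed_vector"
  assumes "X differentiable (at (a + h) within {a..<b})"
  shows "(\<lambda>h. X (a + h)) differentiable (at h within {0..<b - a})"
  using assms has_vector_derivative_shift
  by (metis differentiableI_vector vector_derivative_works)

text \<open>
  The derivative at \<open>a\<close> is returned along with the expansion so that \<open>v\<close> can be identified when
  that derivative is known from a differential equation.
\<close>

lemma taylor1_of_C2:
  fixes X :: "real \<Rightarrow> 'a::euclidean_space"
  assumes "a < b" and X: "Ck_on 2 X {a..<b}"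
  obtains v where "taylor1 (\<lambda>h. X (a + h)) (X a) v"
    and "(X has_vector_derivative v) (at a within {a..<b})"
proof -
  obtain X' where der: "\<And>s. s \<in> {a..<b} \<Longrightarrow> (X has_derivative X' s) (at s within {a..<b})"
    and diff: "\<And>s v. s \<in> {a..<b} \<Longrightarrow> (\<lambda>s. X' s v) differentiable (at s within {a..<b})"
    using Ck_on_2_derivative[OF X] by metis
  have vder: "(X has_vector_derivative X' s 1) (at s within {a..<b})" if "s \<in> {a..<b}" for s
    using der[OF that] has_derivative_linear[OF der[OF that]]
    by (simp add: has_vector_derivative_def linear_cmul[symmetric])
  have "taylor1 (\<lambda>h. X (a + h)) (X (a + 0)) (X' (a + 0) 1)"
  proof (rule taylor1_of_differentiable_derivative[where d = "b - a"])
    show "((\<lambda>h. X (a + h)) has_vector_derivative X' (a + h) 1) (at h within {0..<b - a})"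
      if "h \<in> {0..<b - a}" for h
      using that by (intro has_vector_derivative_shift vder) auto
    show "(\<lambda>h. X' (a + h) 1) differentiable (at 0 within {0..<b - a})"
      using diff[of a 1] \<open>a < b\<close> by (intro differentiable_shift) auto
  qed (use \<open>a < b\<close> in simp)
  with vder[of a] \<open>a < b\<close> show thesis by (intro that) auto
qed

section \<open>Algebraic constraints along curves\<close>

lemma zero_set_tangent:
  fixes \<Psi> :: "'a::euclidean_space \<Rightarrow> 'b::euclidean_space"
  assumes "Ck_on 2 \<Psi> UNIV" "(\<Psi> has_derivative D) (at a)" "taylor1 X a b"
    and "\<Psi> a = 0" "\<forall>\<^sub>F h in at_right 0. \<Psi> (X h) = 0"
  shows "D b = 0"
proof -
  have "vanishes 2 (\<lambda>h. \<Psi> (X h) - h *\<^sub>R D b)"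
    using taylor1_compose[OF assms(1-3)] \<open>\<Psi> a = 0\<close> by (simp add: taylor1_def)
  then have "vanishes (Suc 1) (\<lambda>h. h ^ 1 *\<^sub>R (- D b))"
    unfolding Suc_1 by (rule vanishes_cong_eventually) (use assms(5) in eventually_elim, simp)
  then show ?thesis by (drule_tac vanishes_power_coefficient) simp
qed

lemma strict_derivative_along_filter:
  fixes f :: "'a::euclidean_space \<Rightarrow> 'b::euclidean_space"
  assumes "Ck_on 2 f UNIV" "(f has_derivative D) (at a)"
    and "(X \<longlongrightarrow> a) F" "(Y \<longlongrightarrow> a) F" "e > 0"
  shows "\<forall>\<^sub>F h in F. norm (f (X h) - f (Y h) - D (X h - Y h)) \<le> e * norm (X h - Y h)"
proof -
  obtain C r where "C > 0" "r > 0" and rem: "\<And>x y \<rho>. \<lbrakk>\<rho> < r; norm (x - a) \<le> \<rho>; norm (y - a) \<le> \<rho>\<rbrakk> \<Longrightarrow>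
      norm (f x - f y - D (x - y)) \<le> C * \<rho> * norm (x - y)"
    using strict_derivative_quadratic_remainder[OF assms(1,2)] by metis
  define \<rho> where "\<rho> = min (r / 2) (e / C)"
  have "\<rho> > 0" "\<rho> < r" "C * \<rho> \<le> e"
    using \<open>r > 0\<close> \<open>C > 0\<close> \<open>e > 0\<close> by (auto simp: \<rho>_def min_def field_simps)
  have "\<forall>\<^sub>F h in F. dist (X h) a < \<rho>" "\<forall>\<^sub>F h in F. dist (Y h) a < \<rho>"
    using assms(3,4) \<open>\<rho> > 0\<close> by (auto intro: tendstoD)
  then show ?thesis
  proof eventually_elim
    case (elim h)
    then have "norm (f (X h) - f (Y h) - D (X h - Y h)) \<le> C * \<rho> * norm (X h - Y h)"
      using \<open>\<rho> < r\<close> by (intro rem) (auto simp: dist_norm)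
    also have "\<dots> \<le> e * norm (X h - Y h)"
      using \<open>C * \<rho> \<le> e\<close> by (rule mult_right_mono) simp
    finally show ?case .
  qed
qed

text \<open>
  Both points are within \<open>O(h)\<close> of \<open>a\<close> and within \<open>O(h\<^sup>2)\<close> of each other, so the equality of the
  values of \<open>\<Psi>\<close> gives \<open>D (X h - Y h) = O(h) O(h\<^sup>2) = O(h\<^sup>3)\<close>. On the other hand this vector is
  \<open>h\<^sup>2 D (c - c') + O(h\<^sup>3)\<close>.
\<close>

lemma level_set_second_coefficient:
  fixes \<Psi> :: "'a::euclidean_space \<Rightarrow> 'b::euclidean_space"
  assumes C2: "Ck_on 2 \<Psi> UNIV" and D: "(\<Psi> has_derivative D) (at a)"
    and X: "taylor2 X a b c" and Y: "taylor2 Y a b c'"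
    and eq: "\<forall>\<^sub>F h in at_right 0. \<Psi> (X h) = \<Psi> (Y h)"
  shows "D (c - c') = 0"
proof -
  obtain C r where "C > 0" "r > 0" and rem: "\<And>x y \<rho>. \<lbrakk>\<rho> < r; norm (x - a) \<le> \<rho>; norm (y - a) \<le> \<rho>\<rbrakk> \<Longrightarrow>
      norm (\<Psi> x - \<Psi> y - D (x - y)) \<le> C * \<rho> * norm (x - y)"
    using strict_derivative_quadratic_remainder[OF C2 D] by metis
  have D': "bounded_linear D" using D by (rule has_derivative_bounded_linear)
  obtain K where "K > 0" and K: "\<forall>\<^sub>F h in at_right 0. norm (X h - a) \<le> K * h ^ 1"
    using taylor1_remainder[OF taylor2_imp_taylor1[OF X]] vanishes_pos_bound by blast
  obtain L where "L > 0" and L: "\<forall>\<^sub>F h in at_right 0. norm (Y h - a) \<le> L * h ^ 1"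
    using taylor1_remainder[OF taylor2_imp_taylor1[OF Y]] vanishes_pos_bound by blast
  obtain M where "M > 0" and M: "\<forall>\<^sub>F h in at_right 0. norm (X h - Y h) \<le> M * h\<^sup>2"
    using taylor2_difference_order2[OF X Y] vanishes_pos_bound by blast
  (* For h below this bound, (K + L) h < r bounds the distance of both points from a. *)
  have "0 < r / (K + L)" using \<open>K > 0\<close> \<open>L > 0\<close> \<open>r > 0\<close> by simp
  have "\<forall>\<^sub>F h in at_right 0. norm (D (X h - Y h)) \<le> (C * (K + L) * M) * h ^ 3"
    using K L M eq eventually_0_less_and_less[OF \<open>0 < r / (K + L)\<close>]
  proof eventually_elim
    case (elim h)
    have "norm (\<Psi> (X h) - \<Psi> (Y h) - D (X h - Y h)) \<le> C * ((K + L) * h) * norm (X h - Y h)"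
    proof (rule rem)
      show "(K + L) * h < r" using elim \<open>K > 0\<close> \<open>L > 0\<close> by (simp add: field_simps)
      have "0 < K * h" "0 < L * h" using elim \<open>K > 0\<close> \<open>L > 0\<close> by auto
      then show "norm (X h - a) \<le> (K + L) * h" "norm (Y h - a) \<le> (K + L) * h"
        using elim unfolding distrib_right by auto
    qed
    also have "\<dots> \<le> C * ((K + L) * h) * (M * h\<^sup>2)"
      using elim \<open>K > 0\<close> \<open>L > 0\<close> \<open>C > 0\<close> by (intro mult_left_mono) auto
    finally show ?case using elim by (simp add: power2_eq_square power3_eq_cube ac_simps)
  qed
  then have "vanishes 3 (\<lambda>h. D (X h - Y h))" by (rule vanishesI)
  from vanishes_diff[OF this vanishes_linear_image[OF taylor2_difference[OF X Y] D']]
  have "vanishes (Suc 2) (\<lambda>h. h ^ 2 *\<^sub>R D (c - c'))"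
    by (simp add: linear_diff[OF bounded_linear.linear[OF D']]
        linear_cmul[OF bounded_linear.linear[OF D']])
  then show ?thesis by (rule vanishes_power_coefficient)
qed

text \<open>
  The Lipschitz part of the implicit function theorem, for solution curves that are already given:
  \<open>D (X h - Y h, U h - W h)\<close> is at most half of \<open>c\<close> times the norm of its argument, where \<open>c\<close> is a lower bound
  for the injective map \<open>n \<mapsto> D (0, n)\<close>. The part of this bound that contains \<open>U h - W h\<close> is absorbed on the left.
\<close>

lemma implicit_solution_stability:
  fixes \<Psi> :: "'a::euclidean_space \<times> 'b::euclidean_space \<Rightarrow> 'c::euclidean_space"
  assumes C2: "Ck_on 2 \<Psi> UNIV" and D: "(\<Psi> has_derivative D) (at (a, u))"
    and inj: "\<And>n. D (0, n) = 0 \<Longrightarrow> n = 0"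
    and lim: "(X \<longlongrightarrow> a) (at_right 0)" "(Y \<longlongrightarrow> a) (at_right 0)"
      "(U \<longlongrightarrow> u) (at_right 0)" "(W \<longlongrightarrow> u) (at_right 0)"
    and eq: "\<forall>\<^sub>F h in at_right 0. \<Psi> (X h, U h) = \<Psi> (Y h, W h)"
    and XY: "vanishes k (\<lambda>h. X h - Y h)"
  shows "vanishes k (\<lambda>h. U h - W h)"
proof -
  have D': "bounded_linear D" using D by (rule has_derivative_bounded_linear)
  have lin: "linear D" using D' by (rule bounded_linear.linear)
  have emb: "linear (\<lambda>n. (0 :: 'a, n :: 'b))" by (auto intro!: linearI)
  have lin0: "linear (\<lambda>n. D (0, n))"
    using linear_compose[OF emb lin] by (simp add: o_def)
  have "inj (\<lambda>n. D (0, n))"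
    using inj linear_injective_0[OF lin0] by auto
  then obtain c where "c > 0" and c: "\<And>n. c * norm n \<le> norm (D (0, n))"
    using linear_inj_bounded_below_pos[OF lin0] by metis
  obtain K where "K > 0" and K: "\<And>x. norm (D x) \<le> norm x * K"
    using D' bounded_linear.pos_bounded by blast
  have lims: "((\<lambda>h. (X h, U h)) \<longlongrightarrow> (a, u)) (at_right 0)" "((\<lambda>h. (Y h, W h)) \<longlongrightarrow> (a, u)) (at_right 0)"
    using lim by (auto intro: tendsto_Pair)
  obtain M where M: "\<forall>\<^sub>F h in at_right 0. norm (X h - Y h) \<le> M * h ^ k"
    using XY by (auto simp: vanishes_def)
  have "c / 2 > 0" using \<open>c > 0\<close> by simp
  note rem = strict_derivative_along_filter[OF C2 D lims this]
  have "\<forall>\<^sub>F h in at_right 0. norm (U h - W h) \<le> (2 * (K / c + 1 / 2) * M) * h ^ k"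
    using rem eq M
  proof eventually_elim
    case (elim h)
    let ?x = "X h - Y h" and ?n = "U h - W h"
    have "D (?x, ?n) = D (?x, 0) + D (0, ?n)" by (simp add: linear_add[OF lin, symmetric])
    then have "c * norm ?n \<le> norm (D (?x, ?n)) + norm (D (?x, 0))"
      using c[of ?n] norm_triangle_ineq4[of "D (?x, ?n)" "D (?x, 0)"] by simp
    moreover have "norm (D (?x, ?n)) \<le> c / 2 * norm (?x, ?n)" using elim by simp
    moreover have "c / 2 * norm (?x, ?n) \<le> c / 2 * (norm ?x + norm ?n)"
      using \<open>c > 0\<close> norm_Pair_le[of ?x ?n] by (intro mult_left_mono) auto
    moreover have "norm (D (?x, 0)) \<le> K * norm ?x" using K[of "(?x, 0)"] by (simp add: mult.commute)
    ultimately have "c * norm ?n \<le> (2 * K + c) * norm ?x" by (simp add: algebra_simps)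
    then have "norm ?n \<le> (2 * (K / c + 1 / 2)) * norm ?x"
      using \<open>c > 0\<close> by (simp add: field_simps)
    also have "\<dots> \<le> (2 * (K / c + 1 / 2)) * (M * h ^ k)"
      using elim \<open>c > 0\<close> \<open>K > 0\<close> by (intro mult_left_mono) auto
    finally show ?case by (simp add: mult.assoc)
  qed
  then show ?thesis by (rule vanishesI)
qed

section \<open>Jacobian matrices\<close>

lemma jacobian_mult:
  fixes F :: "real^'a \<Rightarrow> real^'b"
  assumes "(F has_derivative D) (at v)"
  shows "jacobian F (at v) *v n = D n"
proof -
  have "(F has_derivative (*v) (jacobian F (at v))) (at v)"
    using assms jacobian_works[of F "at v"] by (auto simp: differentiable_def)
  with assms show ?thesis using has_derivative_unique by metis
qed

lemma partial_jacobian_mult: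
  fixes F :: "(real^'a) \<times> (real^'b) \<Rightarrow> real^'c"
  assumes "(F has_derivative D) (at (v, u))"
  shows "jacobian (\<lambda>w. F (v, w)) (at u) *v n = D (0, n)"
proof (rule jacobian_mult)
  show "((\<lambda>w. F (v, w)) has_derivative (\<lambda>n. D (0, n))) (at u)"
    by (rule has_derivative_compose[where f = "\<lambda>w. (v, w)" and f' = "\<lambda>n. (0, n)", OF _ assms])
      (auto intro!: derivative_eq_intros)
qed

lemma invertible_mult_eq_0:
  fixes A :: "real^'a^'a"
  assumes "invertible A" "A *v n = 0" shows "n = 0"
  using inj_matrix_vector_mult[OF assms(1)] assms(2) by (metis injD matrix_vector_mult_0_right)

section \<open>Second-order expansions of the exact and the numerical solution\<close>

lemma Ck_on_2_has_derivative:
  assumes "Ck_on 2 f UNIV" obtains D where "(f has_derivative D) (at x)"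
  using Ck_on_2_derivative[OF assms] by (metis UNIV_I)

text \<open>
  The stage is implicit in \<open>V1\<close>. Some first-order expansion of \<open>V1\<close> is presupposed; inserted on the
  right-hand side, it determines its own coefficient, since \<open>P\<close> is multiplied by \<open>h\<close>.
\<close>

lemma first_stage_expansion:
  fixes P :: "'v::euclidean_space \<Rightarrow> 'v" and H :: "'v \<times> 'u::euclidean_space \<Rightarrow> 'v"
  assumes P: "Ck_on 2 P UNIV" and H: "Ck_on 2 H UNIV"
    and V1: "taylor1 V1 v0 v1" and U: "taylor1 U u0 m0"
    and stage: "\<forall>\<^sub>F h in at_right 0.
      V1 h = v0 + (h/2) *\<^sub>R P v0 + (h/2) *\<^sub>R P (V1 h) + h *\<^sub>R H (v0, U h)"
  shows "taylor1 V1 v0 (P v0 + H (v0, u0))"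
proof -
  obtain DP where DP: "(P has_derivative DP) (at v0)" using Ck_on_2_has_derivative[OF P] .
  obtain DH where DH: "(H has_derivative DH) (at (v0, u0))" using Ck_on_2_has_derivative[OF H] .
  let ?K = "\<lambda>h. (1/2) *\<^sub>R P v0 + (1/2) *\<^sub>R P (V1 h) + H (v0, U h)"
  have "taylor1 ?K ((1/2) *\<^sub>R P v0 + (1/2) *\<^sub>R P v0 + H (v0, u0)) (0 + (1/2) *\<^sub>R DP v1 + DH (0, m0))"
    by (intro taylor1_add taylor1_scaleR taylor1_const taylor1_compose[OF P DP V1]
        taylor1_compose[OF H DH taylor1_Pair[OF taylor1_const U]])
  then have "taylor2 V1 v0 ((1/2) *\<^sub>R P v0 + (1/2) *\<^sub>R P v0 + H (v0, u0)) (0 + (1/2) *\<^sub>R DP v1 + DH (0, m0))"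
    by (rule taylor2_increment) (use stage in eventually_elim, simp add: scaleR_add_right add.assoc)
  then show ?thesis
    by (auto dest: taylor2_imp_taylor1 simp: scaleR_left_distrib[symmetric])
qed

text \<open>
  Inserting \<open>V2 = v0 + h w + O(h\<^sup>2)\<close> in the implicit equation gives a second-order expansion with linear
  coefficient \<open>F\<close> whatever \<open>w\<close> is; a second pass with \<open>w = F\<close> then corrects the quadratic
  coefficient. The two evaluations of \<open>H\<close> contribute \<open>DH (0, m0)\<close> and \<open>DH (F, m1)\<close>, so that only the
  sum of the increments of the algebraic variables matters.
\<close>

lemma second_stage_expansion:
  fixes P :: "'v::euclidean_space \<Rightarrow> 'v" and H :: "'v \<times> 'u::euclidean_space \<Rightarrow> 'v"
  assumes P: "Ck_on 2 P UNIV" and H: "Ck_on 2 H UNIV"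
    and DP: "(P has_derivative DP) (at v0)" and DH: "(H has_derivative DH) (at (v0, u0))"
    and V1: "taylor1 V1 v0 (P v0 + H (v0, u0))" and V2: "taylor1 V2 v0 v2"
    and U0: "taylor1 U0 u0 m0" and U1: "taylor1 U1 u0 m1"
    and stage: "\<forall>\<^sub>F h in at_right 0. V2 h = v0 + (h/2) *\<^sub>R P v0 + (h/2) *\<^sub>R P (V2 h)
      + (h/2) *\<^sub>R H (v0, U0 h) + (h/2) *\<^sub>R H (V1 h, U1 h)"
  shows "taylor2 V2 v0 (P v0 + H (v0, u0))
    ((1/2) *\<^sub>R (DP (P v0 + H (v0, u0)) + DH (P v0 + H (v0, u0), m0 + m1)))"
proof -
  let ?F = "P v0 + H (v0, u0)"
  let ?K = "\<lambda>h. (1/2) *\<^sub>R (P v0 + P (V2 h) + (H (v0, U0 h) + H (V1 h, U1 h)))"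
  have step: "taylor2 V2 v0 ?F ((1/2) *\<^sub>R (DP w + DH (?F, m0 + m1)))" if w: "taylor1 V2 v0 w" for w
  proof (rule taylor2_increment)
    have "taylor1 ?K ((1/2) *\<^sub>R (P v0 + P v0 + (H (v0, u0) + H (v0, u0))))
        ((1/2) *\<^sub>R (0 + DP w + (DH (0, m0) + DH (?F, m1))))"
      by (intro taylor1_add taylor1_scaleR taylor1_const taylor1_compose[OF P DP w]
          taylor1_compose[OF H DH taylor1_Pair[OF taylor1_const U0]]
          taylor1_compose[OF H DH taylor1_Pair[OF V1 U1]])
    moreover have "(1/2) *\<^sub>R (P v0 + P v0 + (H (v0, u0) + H (v0, u0))) = ?F"
      by (simp add: scaleR_2[symmetric] scaleR_add_right)
    moreover have "DH (0, m0) + DH (?F, m1) = DH (?F, m0 + m1)"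
      using linear_add[OF has_derivative_linear[OF DH], of "(0, m0)" "(?F, m1)"] by simp
    ultimately show "taylor1 ?K ?F ((1/2) *\<^sub>R (DP w + DH (?F, m0 + m1)))" by simp
    show "\<forall>\<^sub>F h in at_right 0. V2 h = v0 + h *\<^sub>R ?K h"
      using stage by eventually_elim (simp add: scaleR_add_right add.assoc)
  qed
  from step[OF V2] have "taylor1 V2 v0 ?F" by (rule taylor2_imp_taylor1)
  then show ?thesis by (rule step)
qed

lemma exact_velocity_expansion:
  fixes P :: "'v::euclidean_space \<Rightarrow> 'v" and H :: "'v \<times> 'u::euclidean_space \<Rightarrow> 'v"
  assumes P: "Ck_on 2 P UNIV" and H: "Ck_on 2 H UNIV"
    and DP: "(P has_derivative DP) (at (V 0))" and DH: "(H has_derivative DH) (at (V 0, u0))"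
    and U: "taylor1 U u0 m" and V: "taylor1 V (V 0) (P (V 0) + H (V 0, u0))" and "0 < d"
    and ode: "\<And>h. h \<in> {0..<d} \<Longrightarrow>
      (V has_vector_derivative P (V h) + H (V h, U h)) (at h within {0..<d})"
  shows "taylor2 V (V 0) (P (V 0) + H (V 0, u0))
    ((1/2) *\<^sub>R (DP (P (V 0) + H (V 0, u0)) + DH (P (V 0) + H (V 0, u0), m)))"
  by (rule taylor2_antiderivative[OF \<open>0 < d\<close> ode])
    (auto intro!: taylor1_add taylor1_compose[OF P DP V] taylor1_compose[OF H DH taylor1_Pair[OF V U]])

text \<open>
  The right-hand side of the equation of \<open>G\<close> is differentiable at \<open>0\<close> along
  the solution, which yields the first-order expansion and then, by integration, the second-order one.
\<close>

lemma exact_auxiliary_expansion: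
  fixes r :: "'u::euclidean_space \<times> 'g::euclidean_space \<Rightarrow> 'g"
  assumes r: "Ck_on 2 r UNIV" and D: "(r has_derivative D) (at (U 0, G 0))"
    and U: "taylor1 U (U 0) m" "(U has_vector_derivative m) (at 0 within {0..<d})" and "0 < d"
    and ode: "\<And>h. h \<in> {0..<d} \<Longrightarrow> (G has_vector_derivative r (U h, G h)) (at h within {0..<d})"
  shows "taylor2 G (G 0) (r (U 0, G 0)) ((1/2) *\<^sub>R D (m, r (U 0, G 0)))"
proof -
  have "(G has_vector_derivative r (U 0, G 0)) (at 0 within {0..<d})"
    using ode[of 0] \<open>0 < d\<close> by simp
  with U(2) have "((\<lambda>h. (U h, G h)) has_derivative (\<lambda>s. (s *\<^sub>R m, s *\<^sub>R r (U 0, G 0)))) (at 0 within {0..<d})"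
    unfolding has_vector_derivative_def by (rule has_derivative_Pair)
  from has_derivative_compose[OF this D]
  have "(\<lambda>h. r (U h, G h)) differentiable (at 0 within {0..<d})" by (rule differentiableI)
  from taylor1_of_differentiable_derivative[OF \<open>0 < d\<close> ode this]
  have G: "taylor1 G (G 0) (r (U 0, G 0))" .
  show ?thesis
    by (rule taylor2_antiderivative[OF \<open>0 < d\<close> ode taylor1_compose[OF r D taylor1_Pair[OF U(1) G]]])
qed

lemma explicit_trapezoidal_expansion:
  fixes r :: "'u::euclidean_space \<times> 'g::euclidean_space \<Rightarrow> 'g"
  assumes r: "Ck_on 2 r UNIV" and D: "(r has_derivative D) (at (u0, g0))"
    and U0: "taylor1 U0 u0 m0" and U1: "taylor1 U1 u0 m1"
    and g1: "\<forall>\<^sub>F h in at_right 0. g1 h = g0 + h *\<^sub>R r (U0 h, g0)"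
    and g2: "\<forall>\<^sub>F h in at_right 0. g2 h = g0 + (h/2) *\<^sub>R r (U0 h, g0) + (h/2) *\<^sub>R r (U1 h, g1 h)"
  shows "taylor1 g1 g0 (r (u0, g0))"
    and "taylor2 g2 g0 (r (u0, g0)) ((1/2) *\<^sub>R D (m0 + m1, r (u0, g0)))"
proof -
  note r0 = taylor1_compose[OF r D taylor1_Pair[OF U0 taylor1_const]]
  show g1_1: "taylor1 g1 g0 (r (u0, g0))"
    by (rule taylor2_imp_taylor1[OF taylor2_increment[OF r0 g1]])
  let ?K = "\<lambda>h. (1/2) *\<^sub>R (r (U0 h, g0) + r (U1 h, g1 h))"
  show "taylor2 g2 g0 (r (u0, g0)) ((1/2) *\<^sub>R D (m0 + m1, r (u0, g0)))"
  proof (rule taylor2_increment)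
    have "taylor1 ?K ((1/2) *\<^sub>R (r (u0, g0) + r (u0, g0)))
        ((1/2) *\<^sub>R (D (m0, 0) + D (m1, r (u0, g0))))"
      by (intro taylor1_scaleR taylor1_add r0 taylor1_compose[OF r D taylor1_Pair[OF U1 g1_1]])
    then show "taylor1 ?K (r (u0, g0)) ((1/2) *\<^sub>R D (m0 + m1, r (u0, g0)))"
      using linear_add[OF has_derivative_linear[OF D], of "(m0, 0)" "(m1, r (u0, g0))"]
      by (simp add: scaleR_2[symmetric])
    show "\<forall>\<^sub>F h in at_right 0. g2 h = g0 + h *\<^sub>R ?K h"
      using g2 by eventually_elim (simp add: scaleR_add_right add.assoc)
  qed
qed

section \<open>Order of the method\<close>

theorem theorem4p2:
  fixes P :: "real^'m \<Rightarrow> real^'m"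
    and H :: "(real^'m) \<times> (real^'p) \<Rightarrow> real^'m"
    and r_alg :: "(real^'p) \<times> (real^'q) \<Rightarrow> real^'q"
    and r_time :: "real^'q \<Rightarrow> real"
    and con :: "(real^'m, real^'p) constraint"
    and \<tau>\<^sub>n T h\<^sub>0 :: real
    and V_star :: "real^'m" and \<mu>_star :: "real^'p" and g_star :: "real^'q" and t_star :: real
    and V :: "real \<Rightarrow> real^'m" and \<mu> :: "real \<Rightarrow> real^'p"
    and g :: "real \<Rightarrow> real^'q" and t :: "real \<Rightarrow> real"
    and V1 V2 :: "real \<Rightarrow> real^'m" and \<mu>0 \<mu>1 \<mu>2 :: "real \<Rightarrow> real^'p"
    and g1 g2 :: "real \<Rightarrow> real^'q" and t1 t2 :: "real \<Rightarrow> real"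
  assumes "Ck_on 3 P UNIV" and "Ck_on 3 H UNIV"
    and "Ck_on 3 r_alg UNIV" and "Ck_on 3 r_time UNIV"
    and "smooth_constraint con"
    and "\<tau>\<^sub>n < T"
    and "consistent_initial_data P H con V_star \<mu>_star"
    and "smooth_solution P H r_alg r_time con {\<tau>\<^sub>n..<T} V \<mu> g t"
    and "V \<tau>\<^sub>n = V_star" and "\<mu> \<tau>\<^sub>n = \<mu>_star" and "g \<tau>\<^sub>n = g_star" and "t \<tau>\<^sub>n = t_star"
    and "\<forall>\<tau>\<in>{\<tau>\<^sub>n..<T}. constraint_regular H con (V \<tau>) (\<mu> \<tau>)"
    and "h\<^sub>0 > 0"
    and "\<forall>h\<in>{0..<h\<^sub>0}. heun_crank_nicolson_step P H r_alg r_time con h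
           (V_star, V1 h, V2 h) (\<mu>0 h, \<mu>1 h, \<mu>2 h) (g_star, g1 h, g2 h) (t_star, t1 h, t2 h)"
    and "Ck_on 3 V1 {0..<h\<^sub>0}" and "Ck_on 3 V2 {0..<h\<^sub>0}"
    and "Ck_on 3 \<mu>0 {0..<h\<^sub>0}" and "Ck_on 3 \<mu>1 {0..<h\<^sub>0}" and "Ck_on 3 \<mu>2 {0..<h\<^sub>0}"
    and "Ck_on 3 g1 {0..<h\<^sub>0}" and "Ck_on 3 g2 {0..<h\<^sub>0}"
    and "Ck_on 3 t1 {0..<h\<^sub>0}" and "Ck_on 3 t2 {0..<h\<^sub>0}"
    and "\<mu>0 0 = \<mu>_star" and "\<mu>1 0 = \<mu>_star" and "\<mu>2 0 = \<mu>_star"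
  shows "(\<lambda>h. norm (V2 h - V (\<tau>\<^sub>n + h))) \<in> O[at_right 0](\<lambda>h. h ^ 3) \<and>
         (\<lambda>h. norm (g2 h - g (\<tau>\<^sub>n + h))) \<in> O[at_right 0](\<lambda>h. h ^ 3) \<and>
         (\<lambda>h. t2 h - t (\<tau>\<^sub>n + h)) \<in> O[at_right 0](\<lambda>h. h ^ 3) \<and>
         (\<forall>\<Psi>. con = Index1 \<Psi> \<longrightarrow>
            (\<lambda>h. norm (\<mu>2 h - \<mu> (\<tau>\<^sub>n + h))) \<in> O[at_right 0](\<lambda>h. h ^ 3))"
proof -
  let ?I = "{\<tau>\<^sub>n..<T}"
  define d where "d = T - \<tau>\<^sub>n"
  have "0 < d" using \<open>\<tau>\<^sub>n < T\<close> by (simp add: d_def)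
  define F0 where "F0 = P V_star + H (V_star, \<mu>_star)"
  define r0 where "r0 = r_alg (\<mu>_star, g_star)"

  have P: "Ck_on 2 P UNIV" and H: "Ck_on 2 H UNIV"
    and ra: "Ck_on 2 r_alg UNIV" and rt: "Ck_on 2 r_time UNIV"
    using assms(1-4) by (auto intro: Ck_on_3_imp_2)
  obtain DP where DP: "(P has_derivative DP) (at V_star)" using Ck_on_2_has_derivative[OF P] .
  obtain DH where DH: "(H has_derivative DH) (at (V_star, \<mu>_star))"
    using Ck_on_2_has_derivative[OF H] .
  obtain Da where Da: "(r_alg has_derivative Da) (at (\<mu>_star, g_star))"
    using Ck_on_2_has_derivative[OF ra] .
  obtain Dt where Dt: "(r_time has_derivative Dt) (at g_star)" using Ck_on_2_has_derivative[OF rt] .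

  define Vx where "Vx = (\<lambda>h. V (\<tau>\<^sub>n + h))"
  define \<mu>x where "\<mu>x = (\<lambda>h. \<mu> (\<tau>\<^sub>n + h))"
  define gx where "gx = (\<lambda>h. g (\<tau>\<^sub>n + h))"
  define tx where "tx = (\<lambda>h. t (\<tau>\<^sub>n + h))"
  have x0: "Vx 0 = V_star" "\<mu>x 0 = \<mu>_star" "gx 0 = g_star" "tx 0 = t_star"
    using assms(9-12) by (simp_all add: Vx_def \<mu>x_def gx_def tx_def)
  have V3: "Ck_on 3 V ?I" and \<mu>3: "Ck_on 3 \<mu> ?I"
    and ode: "\<And>\<tau>. \<tau> \<in> ?I \<Longrightarrow> (V has_vector_derivative P (V \<tau>) + H (V \<tau>, \<mu> \<tau>)) (at \<tau> within ?I)"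
      "\<And>\<tau>. \<tau> \<in> ?I \<Longrightarrow> (g has_vector_derivative r_alg (\<mu> \<tau>, g \<tau>)) (at \<tau> within ?I)"
      "\<And>\<tau>. \<tau> \<in> ?I \<Longrightarrow> (t has_vector_derivative r_time (g \<tau>)) (at \<tau> within ?I)"
    and constr: "\<And>\<tau>. \<tau> \<in> ?I \<Longrightarrow> satisfies_constraint con (V \<tau>) (\<mu> \<tau>)"
    using assms(8) by (auto simp: smooth_solution_def)
  have odex: "(Vx has_vector_derivative P (Vx h) + H (Vx h, \<mu>x h)) (at h within {0..<d})"
      "(gx has_vector_derivative r_alg (\<mu>x h, gx h)) (at h within {0..<d})"
      "(tx has_vector_derivative r_time (gx h)) (at h within {0..<d})"
    and constrx: "satisfies_constraint con (Vx h) (\<mu>x h)" if "h \<in> {0..<d}" for h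
  proof -
    have "\<tau>\<^sub>n + h \<in> ?I" using that by (auto simp: d_def)
    from has_vector_derivative_shift[OF ode(1)[OF this]] has_vector_derivative_shift[OF ode(2)[OF this]]
      has_vector_derivative_shift[OF ode(3)[OF this]] constr[OF this]
    show "(Vx has_vector_derivative P (Vx h) + H (Vx h, \<mu>x h)) (at h within {0..<d})"
      "(gx has_vector_derivative r_alg (\<mu>x h, gx h)) (at h within {0..<d})"
      "(tx has_vector_derivative r_time (gx h)) (at h within {0..<d})"
      "satisfies_constraint con (Vx h) (\<mu>x h)"
      by (simp_all add: Vx_def \<mu>x_def gx_def tx_def d_def)
  qed

  obtain m where m: "taylor1 \<mu>x \<mu>_star m" "(\<mu>x has_vector_derivative m) (at 0 within {0..<d})"
  proof (rule taylor1_of_C2[OF \<open>\<tau>\<^sub>n < T\<close> Ck_on_3_imp_2[OF \<mu>3]])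
    fix m
    assume *: "taylor1 (\<lambda>h. \<mu> (\<tau>\<^sub>n + h)) (\<mu> \<tau>\<^sub>n) m" "(\<mu> has_vector_derivative m) (at \<tau>\<^sub>n within ?I)"
    have "(\<mu>x has_vector_derivative m) (at 0 within {0..<d})"
      unfolding \<mu>x_def d_def by (rule has_vector_derivative_shift) (use * in simp)
    with * show thesis using assms(10) by (intro that) (simp_all add: \<mu>x_def)
  qed
  have Vx1: "taylor1 Vx V_star F0"
  proof (rule taylor1_of_C2[OF \<open>\<tau>\<^sub>n < T\<close> Ck_on_3_imp_2[OF V3]])
    fix v
    assume *: "taylor1 (\<lambda>h. V (\<tau>\<^sub>n + h)) (V \<tau>\<^sub>n) v" "(V has_vector_derivative v) (at \<tau>\<^sub>n within ?I)"
    have "(V has_vector_derivative F0) (at \<tau>\<^sub>n within ?I)"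
      using ode(1)[of \<tau>\<^sub>n] \<open>\<tau>\<^sub>n < T\<close> assms(9,10) by (simp add: F0_def)
    moreover have "at \<tau>\<^sub>n within ?I \<noteq> bot"
      unfolding trivial_limit_within
      using islimpt_subset[OF islimpt_greaterThanLessThan1[OF \<open>\<tau>\<^sub>n < T\<close>], of ?I]
      by (simp add: greaterThanLessThan_subseteq_atLeastLessThan_iff)
    ultimately have "v = F0" using *(2) vector_derivative_unique_within by blast
    with * show ?thesis using assms(9) by (simp add: Vx_def)
  qed
  have Vx2: "taylor2 Vx V_star F0 ((1/2) *\<^sub>R (DP F0 + DH (F0, m)))"
    using exact_velocity_expansion[OF P H, of DP Vx DH \<mu>_star \<mu>x m d] DP DH m Vx1 \<open>0 < d\<close> odex(1)
    unfolding x0 F0_def by blast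
  have gx2: "taylor2 gx g_star r0 ((1/2) *\<^sub>R Da (m, r0))"
    using exact_auxiliary_expansion[OF ra, of Da \<mu>x gx m d] Da m \<open>0 < d\<close> odex(2)
    unfolding x0 r0_def by blast
  have tx2: "taylor2 tx t_star (r_time g_star) ((1/2) *\<^sub>R Dt r0)"
    using taylor2_antiderivative[OF \<open>0 < d\<close> odex(3)
        taylor1_compose[OF rt Dt taylor2_imp_taylor1[OF gx2]]] unfolding x0 .

  have step: "heun_crank_nicolson_step P H r_alg r_time con h
           (V_star, V1 h, V2 h) (\<mu>0 h, \<mu>1 h, \<mu>2 h) (g_star, g1 h, g2 h) (t_star, t1 h, t2 h)"
    if "h \<in> {0..<h\<^sub>0}" for h
    using assms(15) that by blast
  note step_eqs = step[unfolded heun_crank_nicolson_step_def prod.case]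
  have small: "\<forall>\<^sub>F h in at_right 0. h \<in> {0..<h\<^sub>0} \<and> h \<in> {0..<d}"
    using eventually_0_less_and_less[OF \<open>h\<^sub>0 > 0\<close>] eventually_0_less_and_less[OF \<open>0 < d\<close>] by eventually_elim auto
  have expand: "\<exists>v. taylor1 X (X 0) v" if "Ck_on 3 X {0..<h\<^sub>0}" for X :: "real \<Rightarrow> 'x::euclidean_space"
    using taylor1_of_C2[OF \<open>h\<^sub>0 > 0\<close> Ck_on_3_imp_2[OF that]] by auto
  have "V1 0 = V_star" "V2 0 = V_star" using step_eqs[of 0] \<open>h\<^sub>0 > 0\<close> by auto
  then obtain v1 v2 m0 m1 m2 where jets: "taylor1 V1 V_star v1" "taylor1 V2 V_star v2"
      "taylor1 \<mu>0 \<mu>_star m0" "taylor1 \<mu>1 \<mu>_star m1" "taylor1 \<mu>2 \<mu>_star m2"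
    using expand[OF assms(16)] expand[OF assms(17)] expand[OF assms(18)] expand[OF assms(19)]
      expand[OF assms(20)] assms(25-27) by auto
  have V1: "taylor1 V1 V_star F0"
    unfolding F0_def
    by (rule first_stage_expansion[OF P H jets(1,3)])
      (use small in eventually_elim, use step_eqs in blast)
  have V2: "taylor2 V2 V_star F0 ((1/2) *\<^sub>R (DP F0 + DH (F0, m0 + m1)))"
    unfolding F0_def
    by (rule second_stage_expansion[OF P H DP DH V1[unfolded F0_def] jets(2-4)])
      (use small in eventually_elim, use step_eqs in blast)
  have "\<forall>\<^sub>F h in at_right 0. g1 h = g_star + h *\<^sub>R r_alg (\<mu>0 h, g_star)"
    and "\<forall>\<^sub>F h in at_right 0. g2 h = g_star + (h/2) *\<^sub>R r_alg (\<mu>0 h, g_star) + (h/2) *\<^sub>R r_alg (\<mu>1 h, g1 h)"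
    using small by (eventually_elim, use step_eqs in blast)+
  note g = explicit_trapezoidal_expansion[OF ra Da jets(3,4) this, folded r0_def]
  have t2: "taylor2 t2 t_star (r_time g_star) ((1/2) *\<^sub>R Dt r0)"
  proof (rule taylor2_increment)
    have "taylor1 (\<lambda>h. (1/2) *\<^sub>R (r_time g_star + r_time (g1 h)))
        ((1/2) *\<^sub>R (r_time g_star + r_time g_star)) ((1/2) *\<^sub>R (0 + Dt r0))"
      by (intro taylor1_add taylor1_scaleR taylor1_const taylor1_compose[OF rt Dt g(1)])
    then show "taylor1 (\<lambda>h. (1/2) *\<^sub>R (r_time g_star + r_time (g1 h))) (r_time g_star) ((1/2) *\<^sub>R Dt r0)"
      by simp
    have t2_eq: "t2 h = t_star + (h/2) * r_time g_star + (h/2) * r_time (g1 h)"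
      if "h \<in> {0..<h\<^sub>0}" for h using step_eqs[OF that] by blast
    show "\<forall>\<^sub>F h in at_right 0. t2 h = t_star + h *\<^sub>R ((1/2) *\<^sub>R (r_time g_star + r_time (g1 h)))"
      using small by eventually_elim (simp add: t2_eq algebra_simps)
  qed

  have reg: "constraint_regular H con V_star \<mu>_star"
    using assms(9,10,13) \<open>\<tau>\<^sub>n < T\<close> by force
  (* The constraint enters only here: the increments of the two stages together equal the
     exact increment of the algebraic variable. *)
  have sum: "m0 + m1 = m"
  proof (cases con)
    case (Index1 \<Psi>)
    have \<Psi>: "Ck_on 2 \<Psi> UNIV" using assms(5) Index1 by (simp add: Ck_on_3_imp_2)
    obtain D where D: "(\<Psi> has_derivative D) (at (V_star, \<mu>_star))"
      using Ck_on_2_has_derivative[OF \<Psi>] .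
    note lin = has_derivative_linear[OF D]
    have \<Psi>0: "\<Psi> (V_star, \<mu>_star) = 0" using assms(7) Index1 by simp
    have "\<forall>\<^sub>F h in at_right 0. \<Psi> (V_star, \<mu>0 h) = 0" "\<forall>\<^sub>F h in at_right 0. \<Psi> (V1 h, \<mu>1 h) = 0"
      "\<forall>\<^sub>F h in at_right 0. \<Psi> (Vx h, \<mu>x h) = 0"
      using small by (eventually_elim, use step_eqs constrx Index1 in force)+
    then have "D (0, m0) = 0" "D (F0, m1) = 0" "D (F0, m) = 0"
      using zero_set_tangent[OF \<Psi> D _ \<Psi>0] taylor1_Pair[OF taylor1_const jets(3)]
        taylor1_Pair[OF V1 jets(4)] taylor1_Pair[OF Vx1 m(1)] by metis+
    then have "D (0, m0 + m1 - m) = 0"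
      using linear_add[OF lin, of "(0, m0)" "(F0, m1)"]
        linear_diff[OF lin, of "(F0, m0 + m1)" "(F0, m)"] by simp
    then have "jacobian (\<lambda>w. \<Psi> (V_star, w)) (at \<mu>_star) *v (m0 + m1 - m) = 0"
      by (simp add: partial_jacobian_mult[OF D])
    then show ?thesis using invertible_mult_eq_0 reg Index1 by force
  next
    case (Index2 \<Psi>)
    have \<Psi>: "Ck_on 2 \<Psi> UNIV" using assms(5) Index2 by (simp add: Ck_on_3_imp_2)
    obtain D where D: "(\<Psi> has_derivative D) (at V_star)"
      using Ck_on_2_has_derivative[OF \<Psi>] .
    have "\<forall>\<^sub>F h in at_right 0. \<Psi> (V2 h) = \<Psi> (Vx h)"
      using small by (eventually_elim, use step_eqs constrx Index2 in force)
    from level_set_second_coefficient[OF \<Psi> D V2 Vx2 this]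
    have "D ((1/2) *\<^sub>R (DH (F0, m0 + m1) - DH (F0, m))) = 0"
      by (simp add: scaleR_diff_right[symmetric])
    moreover have "DH (F0, m0 + m1) - DH (F0, m) = DH (0, m0 + m1 - m)"
      using linear_diff[OF has_derivative_linear[OF DH], of "(F0, m0 + m1)" "(F0, m)"] by simp
    ultimately have "D (DH (0, m0 + m1 - m)) = 0"
      by (simp add: linear_cmul[OF has_derivative_linear[OF D]])
    then have "(jacobian \<Psi> (at V_star) ** jacobian (\<lambda>w. H (V_star, w)) (at \<mu>_star)) *v (m0 + m1 - m) = 0"
      by (simp add: matrix_vector_mul_assoc[symmetric] partial_jacobian_mult[OF DH] jacobian_mult[OF D])
    then show ?thesis using invertible_mult_eq_0 reg Index2 by force
  qed

  have errV: "vanishes 3 (\<lambda>h. V2 h - Vx h)"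
    using taylor2_difference[OF V2[unfolded sum] Vx2] by simp
  have errg: "vanishes 3 (\<lambda>h. g2 h - gx h)"
    using taylor2_difference[OF g(2)[unfolded sum] gx2] by simp
  have errt: "vanishes 3 (\<lambda>h. t2 h - tx h)"
    using taylor2_difference[OF t2 tx2] by simp
  have err\<mu>: "vanishes 3 (\<lambda>h. \<mu>2 h - \<mu>x h)" if Index1: "con = Index1 \<Psi>" for \<Psi>
  proof -
    have \<Psi>: "Ck_on 2 \<Psi> UNIV" using assms(5) Index1 by (simp add: Ck_on_3_imp_2)
    obtain D where D: "(\<Psi> has_derivative D) (at (V_star, \<mu>_star))"
      using Ck_on_2_has_derivative[OF \<Psi>] .
    have "n = 0" if "D (0, n) = 0" for n
      using invertible_mult_eq_0 reg Index1 that by (force simp: partial_jacobian_mult[OF D, symmetric])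
    moreover have "\<forall>\<^sub>F h in at_right 0. \<Psi> (V2 h, \<mu>2 h) = \<Psi> (Vx h, \<mu>x h)"
      using small by (eventually_elim, use step_eqs constrx Index1 in force)
    ultimately show ?thesis
      using implicit_solution_stability[OF \<Psi> D _ taylor1_tendsto[OF jets(2)] taylor1_tendsto[OF Vx1]
          taylor1_tendsto[OF jets(5)] taylor1_tendsto[OF m(1)]] errV by blast
  qed
  have "(\<lambda>h. t2 h - tx h) \<in> O[at_right 0](\<lambda>h. h ^ 3)"
    using vanishes_imp_bigo[OF errt] by simp
  with vanishes_imp_bigo[OF errV] vanishes_imp_bigo[OF errg] vanishes_imp_bigo[OF err\<mu>]
  show ?thesis by (simp add: Vx_def \<mu>x_def gx_def tx_def)
qed

end
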